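(* Let $\rho,\kappa>-1$ be real numbers, $m\ge 0$ an integer and $n$ an integer with $n+\rho\ge 0$. The fractional Zernike functions $\mathcal{Z}^{\kappa,\rho}_{m,n}$ are polynomials in $z$ and $\bar z$ if and only if $\rho=0$ or $m\le n$. Alternatively, they are poly-meromorphic functions on $\mathbb{D}$ of order $m$ with $0$ as unique pole. Its order of multiplicity $\mathrm{Ord}^{\kappa,\rho}_{m,n}$ is given by: - $\mathrm{Ord}^{\kappa,\rho}_{m,n}=\rho$ for $m>n+\rho$ when $\rho=1,2,\dots$; - $\mathrm{Ord}^{\kappa,\rho}_{m,n}=m-n$ for $m>n$ when $\rho>-1$ is non-integer, or when $n<m\le n+\rho$ with $\rho=1,2,\dots$.
   Context: Let $\mathbb{D}=\{z\in\mathbb{C}:|z|<1\}$ and $\mathbb{D}^*=\mathbb{D}\setminus\{0\}$; $\partial/\partial z$ is the Wirtinger derivative. For reals $\rho,\kappa>-1$ and integers $m\ge0$, $n$ with $n+\rho\ge0$, the fractional Zernike function on $\mathbb{D}^*$ is $$\mathcal{Z}^{\kappa,\rho}_{m,n}(z,\bar z)=(-1)^m z^{-\rho}(1-|z|^2)^{-\kappa}\frac{\partial^m}{\partial z^m}\Big(z^{n+\rho}(1-|z|^2)^{\kappa+m}\Big),$$ the powers $z^{-\rho}$ and $z^{n+\rho}$ being taken with the same local branch (the result does not depend on the choice). A complex-valued function $f$ on an open set $U\subseteq\mathbb{C}$ is called poly-meromorphic of order $N$ (of first kind) if there are meromorphic functions $\psi_0,\dots,\psi_{N-1}$ on $U$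 with $f(z)=\psi_0(z)+\bar z\psi_1(z)+\cdots+\bar z^{N-1}\psi_{N-1}(z)$. The poles are those of the coefficient functions of the powers of $\bar z$, and the order of multiplicity of a pole is the largest order of that pole among these coefficient functions.
   Formalization: "Of order m" is proved as order m+1, i.e. coefficient functions ψ_0,…,ψ_m (degree m in z̄): with the stated definition of order, order m is false, e.g. m=0, n=-1, ρ=1 gives 1/z, while order 0 means the zero function. *)

theory Defs
  imports "HOL-Complex_Analysis.Complex_Analysis"
begin

abbreviation unit_disc :: "complex set" where
  "unit_disc \<equiv> ball 0 1"

abbreviation punctured_disc :: "complex set" where
  "punctured_disc \<equiv> ball 0 1 - {0}"

text \<open>The operator \<open>\<partial>/\<partial>z = (\<partial>/\<partial>x - \<i> \<partial>/\<partial>y) / 2\<close>. It is applied below only to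
  functions that are smooth, in the real sense, near the point considered.\<close>

definition wirtinger :: "(complex \<Rightarrow> complex) \<Rightarrow> complex \<Rightarrow> complex" where
  "wirtinger f z =
     (vector_derivative (\<lambda>t::real. f (z + of_real t)) (at 0)
       - \<i> * vector_derivative (\<lambda>t::real. f (z + \<i> * of_real t)) (at 0)) / 2"

text \<open>A branch of the logarithm that is holomorphic near the given nonzero point \<open>z\<^sub>0\<close>, with value
  \<open>Ln z\<^sub>0\<close> there. The principal branch itself cannot be used: it jumps across the negative real axis,
  so the derivatives of its powers do not exist there.\<close>

definition local_Ln :: "complex \<Rightarrow> complex \<Rightarrow> complex" where
  "local_Ln z0 w = Ln z0 + Ln (w / z0)"

text \<open>Meaningful for \<open>0 < |z| < 1\<close>. Both powers of \<open>z\<close> use the branch \<open>local_Ln z\<close>; passing to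
  another branch multiplies them by the mutually inverse constants \<open>exp (\<plusminus>2\<pi>\<i>k\<rho>)\<close>, because \<open>n\<close> is an
  integer. The powers of \<open>1 - |w|\<^sup>2 > 0\<close> are real powers.\<close>

definition frac_zernike :: "real \<Rightarrow> real \<Rightarrow> nat \<Rightarrow> int \<Rightarrow> complex \<Rightarrow> complex" where
  "frac_zernike \<kappa> \<rho> m n z =
     (-1) ^ m * exp (- of_real \<rho> * local_Ln z z) * of_real ((1 - (cmod z)\<^sup>2) powr (-\<kappa>)) *
     (wirtinger ^^ m)
       (\<lambda>w. exp (of_real (of_int n + \<rho>) * local_Ln z w)
            * of_real ((1 - (cmod w)\<^sup>2) powr (\<kappa> + of_nat m))) z"

definition polynomial_z_cnj_on :: "complex set \<Rightarrow> (complex \<Rightarrow> complex) \<Rightarrow> bool" where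
  "polynomial_z_cnj_on S f \<longleftrightarrow>
     (\<exists>(d::nat) (c :: nat \<Rightarrow> nat \<Rightarrow> complex).
        \<forall>z\<in>S. f z = (\<Sum>i\<le>d. \<Sum>j\<le>d. c i j * z ^ i * cnj z ^ j))"

definition coeff_poles :: "complex set \<Rightarrow> nat \<Rightarrow> (nat \<Rightarrow> complex \<Rightarrow> complex) \<Rightarrow> complex set" where
  "coeff_poles U N \<psi> = {a \<in> U. \<exists>k<N. is_pole (\<psi> k) a}"

text \<open>\<open>\<psi> 0, \<dots>, \<psi> (N - 1)\<close> are meromorphic coefficient functions of \<open>f\<close>. They are required to be
  nicely meromorphic, that is, holomorphic off their poles; a function that is just
  meromorphic in the library's sense may have arbitrary values at isolated points. The value of \<open>f\<close>
  at the poles is irrelevant.\<close>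

definition poly_meromorphic_coeffs ::
  "complex set \<Rightarrow> nat \<Rightarrow> (nat \<Rightarrow> complex \<Rightarrow> complex) \<Rightarrow> (complex \<Rightarrow> complex) \<Rightarrow> bool" where
  "poly_meromorphic_coeffs U N \<psi> f \<longleftrightarrow>
     (\<forall>k<N. \<psi> k nicely_meromorphic_on U) \<and>
     (\<forall>z \<in> U - coeff_poles U N \<psi>. f z = (\<Sum>k<N. cnj z ^ k * \<psi> k z))"

definition poly_meromorphic_on :: "complex set \<Rightarrow> nat \<Rightarrow> (complex \<Rightarrow> complex) \<Rightarrow> bool" where
  "poly_meromorphic_on U N f \<longleftrightarrow> (\<exists>\<psi>. poly_meromorphic_coeffs U N \<psi> f)"

text \<open>The order of a pole as a natural number; \<open>zorder\<close> is negative at poles.\<close>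

definition pole_order :: "(complex \<Rightarrow> complex) \<Rightarrow> complex \<Rightarrow> nat" where
  "pole_order g a = (if is_pole g a then nat (- zorder g a) else 0)"

definition pole_multiplicity :: "nat \<Rightarrow> (nat \<Rightarrow> complex \<Rightarrow> complex) \<Rightarrow> complex \<Rightarrow> nat" where
  "pole_multiplicity N \<psi> a = Max ((\<lambda>k. pole_order (\<psi> k) a) ` {..<N})"

end

theory Submission
  imports Defs
begin

text \<open>
  Write \<open>a = n + \<rho>\<close>. The idea is to expand the Rodrigues formula completely in powers of
  \<open>cnj z\<close> and to find that each coefficient function is a single monomial: for \<open>0 < |z| < 1\<close>,

    \<open>Z(z) = \<Sum>\<^sub>k\<^sub>\<le>\<^sub>m c\<^sub>k z^(n - m + k) (cnj z)^k\<close>,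
    \<open>c\<^sub>k = (m choose k) * pochhammer (- a) (m - k) * pochhammer (a + \<kappa> + 1) k\<close>

  (\<open>frac_zernike_expansion\<close>). The coefficient \<open>c\<^sub>k\<close> vanishes exactly when \<open>pochhammer (- a) (m - k)\<close>
  does, that is, when \<open>a\<close> is a natural number smaller than \<open>m - k\<close>; the factor
  \<open>pochhammer (a + \<kappa> + 1) k\<close> is positive because \<open>a \<ge> 0\<close> and \<open>\<kappa> > -1\<close>
  (\<open>zernike_coeff_eq_0_iff\<close>).

  The closed form of \<open>c\<^sub>k\<close> could be obtained by applying the Leibniz rule, expanding the powers of
  \<open>1 - |z|\<^sup>2\<close> and summing with the Chu--Vandermonde identity. It is shorter to guess it for general
  exponents and to verify it by induction on \<open>m\<close>, where it reduces to the two-term recursion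
  \<open>rodrigues_coeff_Suc\<close> (\<open>rodrigues_formula\<close>).

  A decomposition \<open>f = \<Sum>\<^sub>k (cnj z)^k \<psi>\<^sub>k\<close> determines the \<open>\<psi>\<^sub>k\<close>, because the Wirtinger derivative
  with respect to \<open>cnj z\<close> lowers the degree in \<open>cnj z\<close> (\<open>cnj_power_coeffs_unique\<close>). Near every point of the disc, arbitrary coefficient functions
  of \<open>Z\<close> are therefore the monomials above. So the only possible pole is \<open>0\<close>, and its
  multiplicity is the largest \<open>m - n - k\<close> with \<open>c\<^sub>k \<noteq> 0\<close>, as soon as this number is positive
  (\<open>poles_of_poly_meromorphic_coeffs\<close>); if it is not, \<open>Z\<close> is a polynomial. The smallest \<open>k\<close> with
  \<open>c\<^sub>k \<noteq> 0\<close> is \<open>m - a\<close> if \<open>a\<close> is a natural number below \<open>m\<close>, and then the multiplicity is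
  \<open>a - n = \<rho>\<close>; otherwise it is \<open>0\<close>, and the multiplicity is \<open>m - n\<close>.
\<close>

section \<open>Calculus of Wirtinger derivatives\<close>

text \<open>The numbers \<open>p\<close> and \<open>q\<close> are the Wirtinger derivatives of \<open>f\<close> with respect to \<open>z\<close> and to \<open>cnj z\<close>. Stating
  them through the total real derivative keeps existence and value together, so that sums and products
  can be differentiated by rules.\<close>

definition has_wirtinger_derivs ::
  "(complex \<Rightarrow> complex) \<Rightarrow> complex \<Rightarrow> complex \<Rightarrow> complex \<Rightarrow> bool" where
  "has_wirtinger_derivs f p q z \<longleftrightarrow> (f has_derivative (\<lambda>h. p * h + q * cnj h)) (at z)"

lemma wirtinger_eqI:
  assumes "has_wirtinger_derivs f p q z"
  shows "wirtinger f z = p"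
proof -
  have D: "((\<lambda>t::real. f (z + u * of_real t)) has_vector_derivative (p * u + q * cnj u)) (at 0)" for u
  proof -
    have g: "((\<lambda>t::real. z + u * of_real t) has_vector_derivative u) (at 0)"
      by (auto intro!: derivative_eq_intros)
    have "(f has_derivative (\<lambda>h. p * h + q * cnj h)) (at (z + u * of_real 0))"
      using assms by (simp add: has_wirtinger_derivs_def)
    from vector_derivative_diff_chain_within[OF g has_derivative_at_withinI[OF this]]
    show ?thesis by (simp add: o_def)
  qed
  have "vector_derivative (\<lambda>t::real. f (z + of_real t)) (at 0) = p + q"
    using D[of 1] by (intro vector_derivative_at) simp
  moreover have "vector_derivative (\<lambda>t::real. f (z + \<i> * of_real t)) (at 0) = p * \<i> - q * \<i>"
    using D[of \<i>] by (intro vector_derivative_at) simp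
  moreover have "\<i> * (p * \<i> - q * \<i>) = q - p"
    by (simp add: algebra_simps)
  ultimately show ?thesis
    by (simp add: wirtinger_def)
qed

lemma wirtinger_derivs_zero:
  assumes "has_wirtinger_derivs f p q z" "open S" "z \<in> S" "\<And>w. w \<in> S \<Longrightarrow> f w = 0"
  shows "p = 0" "q = 0"
proof -
  have "((\<lambda>w. 0) has_derivative (\<lambda>h. p * h + q * cnj h)) (at z)"
    using has_derivative_transform_within_open[OF _ assms(2,3), of f _ UNIV "\<lambda>w. 0"] assms(1,4)
    by (simp add: has_wirtinger_derivs_def)
  then have e: "(\<lambda>h. p * h + q * cnj h) = (\<lambda>h. 0)"
    using has_derivative_unique has_derivative_const by blast
  from fun_cong[OF e, of 1] fun_cong[OF e, of \<i>]
  have *: "p + q = 0" "\<i> * (p - q) = 0" by (simp_all add: algebra_simps)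
  then have "p + q = 0" "p - q = 0" by auto
  then show "p = 0" "q = 0" by (auto simp: algebra_simps)
qed

lemma has_wirtinger_derivs_cong_open:
  assumes "has_wirtinger_derivs f p q z" "open S" "z \<in> S" "\<And>w. w \<in> S \<Longrightarrow> f w = g w"
  shows "has_wirtinger_derivs g p q z"
  using has_derivative_transform_within_open[OF _ assms(2,3), of f _ UNIV g] assms(1,4)
  by (simp add: has_wirtinger_derivs_def)

lemma has_wirtinger_derivs_holo:
  assumes "(f has_field_derivative p) (at z)"
  shows "has_wirtinger_derivs f p 0 z"
  using assms by (simp add: has_wirtinger_derivs_def has_field_derivative_def)

lemma has_wirtinger_derivs_mult:
  assumes "has_wirtinger_derivs f p q z" "has_wirtinger_derivs g p' q' z"
  shows "has_wirtinger_derivs (\<lambda>w. f w * g w) (p * g z + f z * p') (q * g z + f z * q') z"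
proof -
  have e: "(\<lambda>h. f z * (p' * h + q' * cnj h) + (p * h + q * cnj h) * g z) =
    (\<lambda>h. (p * g z + f z * p') * h + (q * g z + f z * q') * cnj h)"
    by (simp add: algebra_simps)
  show ?thesis
    using has_derivative_mult[OF assms[unfolded has_wirtinger_derivs_def]]
    unfolding has_wirtinger_derivs_def e .
qed

lemma has_wirtinger_derivs_sum:
  assumes "\<And>i. i \<in> I \<Longrightarrow> has_wirtinger_derivs (f i) (p i) (q i) z"
  shows "has_wirtinger_derivs (\<lambda>w. \<Sum>i\<in>I. f i w) (\<Sum>i\<in>I. p i) (\<Sum>i\<in>I. q i) z"
  using has_derivative_sum[of I f "\<lambda>i h. p i * h + q i * cnj h" "at z"] assms
  by (simp add: has_wirtinger_derivs_def sum.distrib sum_distrib_right)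

lemma has_wirtinger_derivs_cnj_power:
  "has_wirtinger_derivs (\<lambda>w. cnj w ^ k) 0 (of_nat k * cnj z ^ (k - 1)) z"
  unfolding has_wirtinger_derivs_def
  by (auto intro!: derivative_eq_intros simp: algebra_simps)

lemma has_wirtinger_derivs_one_minus_cmod_powr:
  assumes "cmod z < 1"
  shows "has_wirtinger_derivs (\<lambda>w. of_real ((1 - (cmod w)\<^sup>2) powr b))
           (- of_real b * of_real ((1 - (cmod z)\<^sup>2) powr (b - 1)) * cnj z)
           (- of_real b * of_real ((1 - (cmod z)\<^sup>2) powr (b - 1)) * z) z"
proof -
  have pos: "0 < 1 - (cmod z)\<^sup>2" using assms by (simp add: power_less_one_iff)
  have "((\<lambda>w. 1 - w \<bullet> w) has_derivative (\<lambda>h. - 2 * (z \<bullet> h))) (at z)"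
    by (auto intro!: derivative_eq_intros simp: inner_commute)
  moreover have "((\<lambda>x. x powr b) has_derivative (\<lambda>h. b * (1 - z \<bullet> z) powr (b - 1) * h)) (at (1 - z \<bullet> z))"
    using has_real_derivative_powr[of "1 - z \<bullet> z" b] pos
    by (simp add: has_field_derivative_def power2_norm_eq_inner)
  ultimately have "((\<lambda>w. (1 - w \<bullet> w) powr b) has_derivative
      (\<lambda>h. b * (1 - z \<bullet> z) powr (b - 1) * (- 2 * (z \<bullet> h)))) (at z)"
    by (rule has_derivative_compose)
  then have "((\<lambda>w. of_real ((1 - (cmod w)\<^sup>2) powr b)) has_derivative
      (\<lambda>h. complex_of_real (b * (1 - (cmod z)\<^sup>2) powr (b - 1) * (- 2 * (z \<bullet> h))))) (at z)"
    unfolding power2_norm_eq_inner by (rule has_derivative_of_real)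
  moreover have "complex_of_real (b * (1 - (cmod z)\<^sup>2) powr (b - 1) * (- 2 * (z \<bullet> h))) =
      - of_real b * of_real ((1 - (cmod z)\<^sup>2) powr (b - 1)) * cnj z * h
      + - of_real b * of_real ((1 - (cmod z)\<^sup>2) powr (b - 1)) * z * cnj h" for h
  proof -
    have "complex_of_real (2 * (z \<bullet> h)) = cnj z * h + z * cnj h"
      by (simp add: complex_eq_iff inner_complex_def)
    moreover have "complex_of_real (b * (1 - (cmod z)\<^sup>2) powr (b - 1) * (- 2 * (z \<bullet> h))) =
        - of_real b * of_real ((1 - (cmod z)\<^sup>2) powr (b - 1)) * complex_of_real (2 * (z \<bullet> h))"
      by simp
    ultimately show ?thesis by (simp only: distrib_left mult.assoc)
  qed
  ultimately show ?thesis by (simp add: has_wirtinger_derivs_def)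
qed

text \<open>Differentiating a vanishing sum \<open>\<Sum>\<^sub>k (cnj z)^k f\<^sub>k\<close>, with holomorphic \<open>f\<^sub>k\<close>, with respect to \<open>cnj z\<close>
  gives the vanishing sum \<open>\<Sum>\<^sub>k (cnj z)^k (k + 1) f\<^sub>k\<^sub>+\<^sub>1\<close> with one term less. By induction, all \<open>f\<^sub>k\<close> with \<open>k \<ge> 1\<close> vanish, and
  then so does the remaining term \<open>f\<^sub>0\<close>.\<close>

lemma cnj_power_coeffs_unique:
  assumes "open S" "\<And>k. k < N \<Longrightarrow> f k holomorphic_on S"
    and "\<And>z. z \<in> S \<Longrightarrow> (\<Sum>k<N. cnj z ^ k * f k z) = 0"
    and "k < N" "z \<in> S"
  shows "f k z = 0"
  using assms(2-)
proof (induction N arbitrary: f k z)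
  case 0
  then show ?case by simp
next
  case (Suc N)
  have "(\<Sum>k<N. cnj w ^ k * (of_nat (Suc k) * f (Suc k) w)) = 0" if w: "w \<in> S" for w
  proof -
    have "has_wirtinger_derivs (\<lambda>z. \<Sum>k<Suc N. cnj z ^ k * f k z)
       (\<Sum>k<Suc N. 0 * f k w + cnj w ^ k * deriv (f k) w)
       (\<Sum>k<Suc N. of_nat k * cnj w ^ (k - 1) * f k w + cnj w ^ k * 0) w"
      using Suc.prems(1) w assms(1)
      by (intro has_wirtinger_derivs_sum has_wirtinger_derivs_mult has_wirtinger_derivs_cnj_power
            has_wirtinger_derivs_holo holomorphic_derivI) auto
    from wirtinger_derivs_zero(2)[OF this assms(1) w] Suc.prems(2)
    have "(\<Sum>k<Suc N. of_nat k * cnj w ^ (k - 1) * f k w) = 0" by simp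
    then show ?thesis by (subst (asm) sum.lessThan_Suc_shift) (simp add: algebra_simps)
  qed
  moreover have "(\<lambda>w. of_nat (Suc k) * f (Suc k) w) holomorphic_on S" if "k < N" for k
    using Suc.prems(1)[of "Suc k"] that by (intro holomorphic_intros) auto
  ultimately have IH: "of_nat (Suc j) * f (Suc j) w = 0" if "j < N" "w \<in> S" for j w
    using Suc.IH[of "\<lambda>k w. of_nat (Suc k) * f (Suc k) w"] that by blast
  have higher: "f (Suc j) w = 0" if "j < N" "w \<in> S" for j w
    using IH[OF that] by (simp del: of_nat_Suc)
  have "f 0 z = 0"
    using Suc.prems(2)[OF Suc.prems(4)] higher[OF _ Suc.prems(4)]
    by (subst (asm) sum.lessThan_Suc_shift) simp
  then show ?case using higher[OF _ Suc.prems(4), of "k - 1"] Suc.prems(3) by (cases k) auto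
qed

section \<open>Expansion of the Rodrigues formula\<close>

text \<open>The number that multiplies \<open>w^(a - m + k) (cnj w)^k (1 - |w|\<^sup>2)^(b - m)\<close> in the \<open>m\<close>-th Wirtinger
  derivative of \<open>w^a (1 - |w|\<^sup>2)^b\<close>.\<close>

definition rodrigues_coeff :: "'a::field_char_0 \<Rightarrow> 'a \<Rightarrow> nat \<Rightarrow> nat \<Rightarrow> 'a" where
  "rodrigues_coeff a b m k =
     (-1) ^ m * of_nat (m choose k) * pochhammer (- a) (m - k) * pochhammer (a + b - of_nat m + 1) k"

lemma rodrigues_coeff_0:
  "rodrigues_coeff a b (Suc m) 0 = (a - of_nat m) * rodrigues_coeff a b m 0"
  by (simp add: rodrigues_coeff_def pochhammer_Suc algebra_simps)

text \<open>Differentiating the \<open>k\<close>-th term once gives, up to a common factor and with \<open>t = |w|\<^sup>2\<close>, the polynomial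
  \<open>(a - m + k) t^k (1 - t) - (b - m) t^(k + 1)\<close>. Collecting powers of \<open>t\<close> yields this recursion. Once
  the common Pochhammer factors are removed, it amounts to
  \<open>(j + 1) (m choose (j + 1)) = (m - j) (m choose j)\<close>.\<close>

lemma rodrigues_coeff_Suc:
  fixes a b :: "'a::field_char_0"
  assumes "j \<le> m"
  shows "rodrigues_coeff a b (Suc m) (Suc j) =
    (a - of_nat m + of_nat (Suc j)) * rodrigues_coeff a b m (Suc j)
    - (a + b - 2 * of_nat m + of_nat j) * rodrigues_coeff a b m j"
proof -
  define x where "x = a + b - of_nat m"
  define Y where "Y = pochhammer (- a) (m - j)"
  define W where "W = pochhammer (x + 1) j"
  define C where "C = (of_nat (m choose j) :: 'a)"
  define C' where "C' = (of_nat (m choose Suc j) :: 'a)"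
  have absorb: "(of_nat j + 1) * C' = (of_nat m - of_nat j) * C"
  proof -
    have "Suc j * (m choose Suc j) = (m - j) * (m choose j)"
      by (metis binomial_absorb_comp binomial_absorption)
    then have "(of_nat (Suc j * (m choose Suc j)) :: 'a) = of_nat ((m - j) * (m choose j))" by simp
    then show ?thesis using assms by (simp add: C_def C'_def distrib_right add.commute)
  qed
  \<comment> \<open>For \<open>j = m\<close> the truncated difference \<open>m - Suc j\<close> is not \<open>m - j - 1\<close>, but then \<open>C' = 0\<close>.\<close>
  have Y: "C' * (a - of_nat m + of_nat (Suc j)) * pochhammer (- a) (m - Suc j) = - C' * Y"
  proof (cases "j = m")
    case True
    then have "C' = 0" by (simp add: C'_def binomial_eq_0)
    then show ?thesis by simp
  next
    case False
    then have "m - j = Suc (m - Suc j)" using assms by simp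
    then have "Y = (- a + of_nat (m - Suc j)) * pochhammer (- a) (m - Suc j)"
      by (simp add: Y_def pochhammer_Suc)
    moreover have "(of_nat (m - Suc j) :: 'a) = of_nat m - of_nat (Suc j)"
      using False assms by (intro of_nat_diff) simp
    ultimately have "Y = (- a + (of_nat m - of_nat (Suc j))) * pochhammer (- a) (m - Suc j)"
      by (simp only:)
    then show ?thesis by (simp only:) (simp add: algebra_simps)
  qed
  have q1: "(a - of_nat m + of_nat (Suc j)) * rodrigues_coeff a b m (Suc j) =
      (-1) ^ m * (C' * (a - of_nat m + of_nat (Suc j)) * pochhammer (- a) (m - Suc j)) * (W * (x + 1 + of_nat j))"
    unfolding rodrigues_coeff_def C'_def W_def x_def pochhammer_Suc by (simp only: ac_simps)
  have q2: "rodrigues_coeff a b m j = (-1) ^ m * C * Y * W"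
    by (simp add: rodrigues_coeff_def C_def Y_def W_def x_def)
  have CC: "(C + C') * x = C' * (x + 1 + of_nat j) + (x - of_nat m + of_nat j) * C"
    using absorb by (simp add: algebra_simps)
  have s: "a + b - 2 * of_nat m + of_nat j = x - of_nat m + of_nat j" by (simp add: x_def)
  have "rodrigues_coeff a b (Suc m) (Suc j) = - ((-1) ^ m) * Y * W * ((C + C') * x)"
    by (simp add: rodrigues_coeff_def C_def C'_def Y_def W_def x_def pochhammer_rec algebra_simps)
  also have "\<dots> = (-1) ^ m * (- C' * Y) * (W * (x + 1 + of_nat j))
      - (x - of_nat m + of_nat j) * ((-1) ^ m * C * Y * W)"
    unfolding CC by (simp add: algebra_simps)
  finally show ?thesis unfolding q1 q2 s Y .
qed


lemma exp_local_Ln: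
  assumes "z0 \<noteq> 0" "w \<noteq> 0"
  shows "exp (local_Ln z0 w) = w"
  using assms by (simp add: local_Ln_def exp_add)

lemma local_Ln_field_derivative:
  assumes "Re (w / z0) > 0"
  shows "(local_Ln z0 has_field_derivative 1 / w) (at w)"
proof -
  have nz: "w \<noteq> 0" "z0 \<noteq> 0" using assms by auto
  have "w / z0 \<notin> \<real>\<^sub>\<le>\<^sub>0" using assms by (auto simp: complex_nonpos_Reals_iff)
  then show ?thesis unfolding local_Ln_def[abs_def] using nz
    by (auto intro!: derivative_eq_intros)
qed

text \<open>The power \<open>w^a\<close>, taken with the branch of the logarithm centred at \<open>z0\<close>.\<close>

definition branch_powr :: "complex \<Rightarrow> complex \<Rightarrow> complex \<Rightarrow> complex" where
  "branch_powr z0 a w = exp (a * local_Ln z0 w)"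

lemma branch_powr_add_nat:
  assumes "z0 \<noteq> 0" "w \<noteq> 0"
  shows "branch_powr z0 (a + of_nat k) w = branch_powr z0 a w * w ^ k"
  using assms by (simp add: branch_powr_def distrib_right exp_add exp_of_nat_mult exp_local_Ln)

lemma branch_powr_field_derivative:
  assumes "Re (w / z0) > 0"
  shows "(branch_powr z0 a has_field_derivative a * branch_powr z0 (a - 1) w) (at w)"
proof -
  have nz: "w \<noteq> 0" "z0 \<noteq> 0" using assms by auto
  have "branch_powr z0 a w = branch_powr z0 (a - 1) w * w"
    using branch_powr_add_nat[OF nz(2,1), of "a - 1" 1] by simp
  then have "exp (a * local_Ln z0 w) * (a * (1 / w)) = a * branch_powr z0 (a - 1) w"
    using nz by (simp add: branch_powr_def)
  then show ?thesis
    unfolding branch_powr_def[abs_def]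
    by (auto intro!: derivative_eq_intros local_Ln_field_derivative assms)
qed

definition disc_weight :: "real \<Rightarrow> complex \<Rightarrow> complex" where
  "disc_weight b w = of_real ((1 - (cmod w)\<^sup>2) powr b)"

text \<open>Differentiation lowers the exponent of the weight in only one of the terms of the product rule; this
  identity brings the others to the same exponent.\<close>

lemma disc_weight_eq_diff_1:
  assumes "cmod w < 1"
  shows "disc_weight b w = disc_weight (b - 1) w * (1 - w * cnj w)"
proof -
  have "0 < 1 - (cmod w)\<^sup>2" using assms by (simp add: power_less_one_iff)
  then have "(1 - (cmod w)\<^sup>2) powr b = (1 - (cmod w)\<^sup>2) powr (b - 1) * (1 - (cmod w)\<^sup>2)"
    using powr_add[of "1 - (cmod w)\<^sup>2" "b - 1" 1] by simp
  then show ?thesis by (simp add: disc_weight_def flip: complex_norm_square)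
qed

text \<open>The formula holds on the whole intersection of the disc with a half-plane on which the branch at
  \<open>z0\<close> is holomorphic, and not only at \<open>z0\<close> itself: to take one more derivative, the previous one must be
  known on an open set, with the centre of the branch kept fixed.\<close>

lemma rodrigues_formula:
  assumes "z0 \<noteq> 0" "cmod w < 1" "Re (w / z0) > 0"
  shows "(wirtinger ^^ m) (\<lambda>w. branch_powr z0 a w * disc_weight b w) w =
    (\<Sum>k\<le>m. rodrigues_coeff a (of_real b) m k *
       (branch_powr z0 (a - of_nat m + of_nat k) w * cnj w ^ k * disc_weight (b - of_nat m) w))"
  using assms(2,3)
proof (induction m arbitrary: w)
  case 0
  then show ?case by (simp add: rodrigues_coeff_def)
next
  case (Suc m)
  define S where "S = ball 0 1 \<inter> {w. Re (w / z0) > 0}"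
  have "continuous_on UNIV (\<lambda>w. Re (w / z0))"
    using assms(1) by (intro continuous_intros) auto
  then have "open S"
    unfolding S_def by (intro open_Int open_ball open_Collect_less continuous_on_const)
  have "w \<in> S" using Suc.prems by (simp add: S_def)
  have "w \<noteq> 0" using Suc.prems by auto
  let ?f = "\<lambda>w. branch_powr z0 a w * disc_weight b w"
  let ?q = "rodrigues_coeff a (of_real b)"
  let ?B = "branch_powr z0" and ?R = "disc_weight"
  define X where "X = ?B (a - of_nat (Suc m)) w * ?R (b - of_nat (Suc m)) w"
  define t where "t = w * cnj w"
  have R1: "?R (b - of_nat m) w = ?R (b - of_nat (Suc m)) w * (1 - t)"
    using disc_weight_eq_diff_1[OF Suc.prems(1), of "b - of_nat m"] by (simp add: t_def diff_diff_eq add.commute)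
  have B1: "?B (a - of_nat (Suc m) + of_nat k) w = ?B (a - of_nat (Suc m)) w * w ^ k" for k
    using assms(1) \<open>w \<noteq> 0\<close> by (rule branch_powr_add_nat)
  \<comment> \<open>\<open>p k\<close> is the derivative of the \<open>k\<close>-th term as the product rule returns it.\<close>
  define p where "p k = (a - of_nat m + of_nat k) * ?B (a - of_nat m + of_nat k - 1) w * cnj w ^ k
      * ?R (b - of_nat m) w
      + ?B (a - of_nat m + of_nat k) w * cnj w ^ k *
        (- of_real (b - of_nat m) * ?R (b - of_nat m - 1) w * cnj w)" for k
  have p: "p k = X * ((a - of_nat m + of_nat k) * t ^ k
      - (a + of_real b - 2 * of_nat m + of_nat k) * t ^ Suc k)" for k
  proof -
    have e: "a - of_nat m + of_nat k - 1 = a - of_nat (Suc m) + of_nat k"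
      "a - of_nat m + of_nat k = a - of_nat (Suc m) + of_nat (Suc k)"
      "b - of_nat m - 1 = b - of_nat (Suc m)" by simp_all
    have "p k = (a - of_nat m + of_nat k) * (?B (a - of_nat (Suc m)) w * w ^ k) * cnj w ^ k
      * (?R (b - of_nat (Suc m)) w * (1 - t))
      + (?B (a - of_nat (Suc m)) w * w ^ Suc k) * cnj w ^ k *
        (- of_real (b - of_nat m) * ?R (b - of_nat (Suc m)) w * cnj w)"
      unfolding p_def R1 B1[symmetric] e(1,3) e(2)[symmetric] ..
    also have "\<dots> = X * ((a - of_nat m + of_nat k) * t ^ k * (1 - t) - (of_real b - of_nat m) * t ^ Suc k)"
      by (simp add: X_def t_def power_mult_distrib algebra_simps)
    finally show ?thesis by (simp add: algebra_simps)
  qed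
  define g where "g w' = (\<Sum>k\<le>m. ?q m k *
       (?B (a - of_nat m + of_nat k) w' * cnj w' ^ k * ?R (b - of_nat m) w'))" for w'
  have "\<exists>q. has_wirtinger_derivs g (\<Sum>k\<le>m. ?q m k * p k) q w"
  proof -
    have "\<exists>q. has_wirtinger_derivs (\<lambda>w'. ?q m k *
       (?B (a - of_nat m + of_nat k) w' * cnj w' ^ k * ?R (b - of_nat m) w')) (?q m k * p k) q w" for k
    proof -
      note D = has_wirtinger_derivs_mult[OF has_wirtinger_derivs_holo[OF DERIV_const]
          has_wirtinger_derivs_mult[OF has_wirtinger_derivs_mult[OF
            has_wirtinger_derivs_holo[OF branch_powr_field_derivative[OF Suc.prems(2)]]
            has_wirtinger_derivs_cnj_power]
            has_wirtinger_derivs_one_minus_cmod_powr[OF Suc.prems(1), folded disc_weight_def]]]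
      from D[of "?q m k" "a - of_nat m + of_nat k" k "b - of_nat m"]
      show ?thesis by (force simp: p_def)
    qed
    then obtain q where "\<And>k. has_wirtinger_derivs (\<lambda>w'. ?q m k *
       (?B (a - of_nat m + of_nat k) w' * cnj w' ^ k * ?R (b - of_nat m) w')) (?q m k * p k) (q k) w"
      by metis
    then have "has_wirtinger_derivs g (\<Sum>k\<le>m. ?q m k * p k) (\<Sum>k\<le>m. q k) w"
      unfolding g_def by (intro has_wirtinger_derivs_sum)
    then show ?thesis ..
  qed
  then obtain q where "has_wirtinger_derivs g (\<Sum>k\<le>m. ?q m k * p k) q w" ..
  then have "has_wirtinger_derivs ((wirtinger ^^ m) ?f) (\<Sum>k\<le>m. ?q m k * p k) q w"
    using \<open>open S\<close> \<open>w \<in> S\<close>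
    by (rule has_wirtinger_derivs_cong_open) (use Suc.IH in \<open>simp add: S_def g_def\<close>)
  then have "(wirtinger ^^ Suc m) ?f w = (\<Sum>k\<le>m. ?q m k * p k)"
    by (simp add: wirtinger_eqI)
  also have "\<dots> = X * ((\<Sum>k\<le>m. (a - of_nat m + of_nat k) * ?q m k * t ^ k)
      - (\<Sum>k\<le>m. (a + of_real b - 2 * of_nat m + of_nat k) * ?q m k * t ^ Suc k))"
    unfolding p sum_subtractf[symmetric] sum_distrib_left
    by (intro sum.cong) (simp_all add: algebra_simps)
  \<comment> \<open>The added term is zero because \<open>m choose Suc m\<close> is.\<close>
  also have "(\<Sum>k\<le>m. (a - of_nat m + of_nat k) * ?q m k * t ^ k) =
      (\<Sum>k\<le>Suc m. (a - of_nat m + of_nat k) * ?q m k * t ^ k)"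
    by (simp add: rodrigues_coeff_def)
  also have "\<dots> = (a - of_nat m) * ?q m 0 +
      (\<Sum>k\<le>m. (a - of_nat m + of_nat (Suc k)) * ?q m (Suc k) * t ^ Suc k)"
    by (subst sum.atMost_Suc_shift) simp
  also have "\<dots> - (\<Sum>k\<le>m. (a + of_real b - 2 * of_nat m + of_nat k) * ?q m k * t ^ Suc k) =
      ?q (Suc m) 0 + (\<Sum>k\<le>m. ?q (Suc m) (Suc k) * t ^ Suc k)"
    unfolding rodrigues_coeff_0 add_diff_eq[symmetric] sum_subtractf[symmetric]
    by (intro arg_cong2[where f = "(+)"] refl sum.cong)
      (simp_all only: rodrigues_coeff_Suc atMost_iff left_diff_distrib add_diff_eq)
  also have "\<dots> = (\<Sum>k\<le>Suc m. ?q (Suc m) k * t ^ k)"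
    by (subst sum.atMost_Suc_shift) simp
  also have "X * \<dots> = (\<Sum>k\<le>Suc m. ?q (Suc m) k *
       (?B (a - of_nat (Suc m) + of_nat k) w * cnj w ^ k * ?R (b - of_nat (Suc m)) w))"
    unfolding B1 X_def t_def sum_distrib_left by (simp add: power_mult_distrib ac_simps)
  finally show ?case .
qed

definition zernike_coeff :: "real \<Rightarrow> real \<Rightarrow> nat \<Rightarrow> nat \<Rightarrow> real" where
  "zernike_coeff \<kappa> a m k =
     of_nat (m choose k) * pochhammer (- a) (m - k) * pochhammer (a + \<kappa> + 1) k"

text \<open>With \<open>b = \<kappa> + m\<close> the derivative carries the weight \<open>(1 - |z|\<^sup>2)^\<kappa>\<close>, which the prefactor cancels, and the
  prefactor \<open>z^(- \<rho>)\<close> turns the branch-dependent powers \<open>z^(n + \<rho> - m + k)\<close> into integer powers. The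
  signs \<open>(-1)^m\<close> cancel.\<close>

lemma frac_zernike_expansion:
  assumes "z \<in> punctured_disc"
  shows "frac_zernike \<kappa> \<rho> m n z =
    (\<Sum>k\<le>m. cnj z ^ k * (of_real (zernike_coeff \<kappa> (of_int n + \<rho>) m k) * z powi (n - int m + int k)))"
proof -
  define a where "a = of_int n + \<rho>"
  have z: "z \<noteq> 0" "cmod z < 1" using assms by auto
  have pos: "0 < 1 - (cmod z)\<^sup>2" using z by (simp add: power_less_one_iff)
  have weight: "of_real ((1 - (cmod z)\<^sup>2) powr (-\<kappa>)) * disc_weight \<kappa> z = 1"
    using pos by (simp add: disc_weight_def powr_minus)
  have power: "branch_powr z (- of_real \<rho>) z * branch_powr z (of_real a - of_nat m + of_nat k) z
      = z powi (n - int m + int k)" for k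
  proof -
    have "branch_powr z (- of_real \<rho>) z * branch_powr z (of_real a - of_nat m + of_nat k) z =
      exp (of_int (n - int m + int k) * Ln z)"
      using z by (simp add: branch_powr_def local_Ln_def a_def algebra_simps flip: exp_add)
    also have "\<dots> = exp (Ln z) powi (n - int m + int k)"
      by (simp only: exp_power_int)
    also have "\<dots> = z powi (n - int m + int k)"
      using z by simp
    finally show ?thesis .
  qed
  have coeff: "(-1) ^ m * rodrigues_coeff (of_real a) (of_real (\<kappa> + of_nat m)) m k =
      complex_of_real (zernike_coeff \<kappa> a m k)" for k
    by (simp add: rodrigues_coeff_def zernike_coeff_def flip: pochhammer_of_real power_mult_distrib mult.assoc)
  have "frac_zernike \<kappa> \<rho> m n z = (-1) ^ m * branch_powr z (- of_real \<rho>) z * 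
     of_real ((1 - (cmod z)\<^sup>2) powr (-\<kappa>)) *
     (\<Sum>k\<le>m. rodrigues_coeff (of_real a) (of_real (\<kappa> + of_nat m)) m k *
       (branch_powr z (of_real a - of_nat m + of_nat k) z * cnj z ^ k * disc_weight \<kappa> z))"
    using rodrigues_formula[OF z, of m "of_real a" "\<kappa> + of_nat m"] z(1)
    by (simp add: frac_zernike_def branch_powr_def disc_weight_def a_def)
  also have "\<dots> = (\<Sum>k\<le>m. cnj z ^ k * (((-1) ^ m * rodrigues_coeff (of_real a) (of_real (\<kappa> + of_nat m)) m k)
      * (branch_powr z (- of_real \<rho>) z * branch_powr z (of_real a - of_nat m + of_nat k) z))
      * (of_real ((1 - (cmod z)\<^sup>2) powr (-\<kappa>)) * disc_weight \<kappa> z))"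
    unfolding sum_distrib_left by (intro sum.cong refl) (simp only: ac_simps)
  finally show ?thesis unfolding power coeff weight by (simp add: a_def)
qed

lemma zernike_coeff_eq_0_iff:
  assumes "\<kappa> > -1" "a \<ge> 0" "k \<le> m"
  shows "zernike_coeff \<kappa> a m k = 0 \<longleftrightarrow> a \<in> \<nat> \<and> a < real (m - k)"
proof -
  have "pochhammer (a + \<kappa> + 1) k > 0" using assms by (intro pochhammer_pos) simp
  then have "zernike_coeff \<kappa> a m k = 0 \<longleftrightarrow> pochhammer (- a) (m - k) = 0"
    using assms by (simp add: zernike_coeff_def)
  also have "\<dots> \<longleftrightarrow> (\<exists>j<m - k. a = of_nat j)" by (simp add: pochhammer_eq_0_iff)
  finally show ?thesis by (auto simp: Nats_def)
qed

section \<open>Sums of monomials in the variable and its conjugate\<close>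

lemma polynomial_if_exponents_nonneg:
  fixes c :: "nat \<Rightarrow> complex" and e :: "nat \<Rightarrow> int"
  assumes f: "\<And>z. z \<in> S \<Longrightarrow> f z = (\<Sum>k<N. cnj z ^ k * (c k * z powi e k))"
    and e: "\<And>k. k < N \<Longrightarrow> c k \<noteq> 0 \<Longrightarrow> e k \<ge> 0"
  shows "polynomial_z_cnj_on S f"
proof -
  define d where "d = N + (\<Sum>k<N. nat (e k))"
  define C where "C i j = (if j < N \<and> i = nat (e j) then c j else 0)" for i j
  have "f z = (\<Sum>i\<le>d. \<Sum>j\<le>d. C i j * z ^ i * cnj z ^ j)" if "z \<in> S" for z
  proof -
    have "(\<Sum>i\<le>d. \<Sum>j\<le>d. C i j * z ^ i * cnj z ^ j) = (\<Sum>j\<le>d. \<Sum>i\<le>d. C i j * z ^ i * cnj z ^ j)"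
      by (rule sum.swap)
    also have "\<dots> = (\<Sum>j<N. \<Sum>i\<le>d. C i j * z ^ i * cnj z ^ j)"
      by (rule sum.mono_neutral_right) (auto simp: d_def C_def)
    also have "\<dots> = (\<Sum>j<N. cnj z ^ j * (c j * z powi e j))"
    proof (rule sum.cong[OF refl])
      fix j assume j: "j \<in> {..<N}"
      have "nat (e j) \<le> (\<Sum>k<N. nat (e k))"
        using j by (intro member_le_sum) auto
      then have "nat (e j) \<le> d" by (simp add: d_def)
      have "(\<Sum>i\<le>d. C i j * z ^ i * cnj z ^ j) =
          (\<Sum>i\<le>d. if i = nat (e j) then c j * z ^ i * cnj z ^ j else 0)"
        using j by (intro sum.cong) (auto simp: C_def)
      also have "\<dots> = c j * z ^ nat (e j) * cnj z ^ j"
        using \<open>nat (e j) \<le> d\<close> by simp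
      also have "\<dots> = cnj z ^ j * (c j * z powi e j)"
        using e[of j] j by (cases "c j = 0") (auto simp: power_int_def)
      finally show "(\<Sum>i\<le>d. C i j * z ^ i * cnj z ^ j) = cnj z ^ j * (c j * z powi e j)" .
    qed
    finally show ?thesis using f[OF that] by simp
  qed
  then show ?thesis unfolding polynomial_z_cnj_on_def by blast
qed

lemma monomial_analytic:
  assumes "z \<noteq> 0 \<or> c = 0 \<or> e \<ge> 0"
  shows "(\<lambda>z::complex. c * z powi e) analytic_on {z}"
proof (cases "c = 0")
  case False
  define A :: "complex set" where "A = (if z \<noteq> 0 then - {0} else UNIV)"
  have "(\<lambda>z. c * z powi e) holomorphic_on A"
    using assms False by (intro holomorphic_intros) (auto simp: A_def)
  moreover have "open A" "z \<in> A" by (auto simp: A_def)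
  ultimately show ?thesis using analytic_at by blast
qed simp

lemma is_pole_monomial_iff:
  "is_pole (\<lambda>z::complex. c * z powi e) a \<longleftrightarrow> a = 0 \<and> c \<noteq> 0 \<and> e < 0"
proof (cases "a = 0 \<and> c \<noteq> 0 \<and> e < 0")
  case True
  have "is_pole (\<lambda>z::complex. 1 / (z - 0) ^ nat (- e)) 0"
    using True by (intro is_pole_inverse_power) simp
  moreover have "(\<lambda>z::complex. 1 / (z - 0) ^ nat (- e)) = (\<lambda>z. z powi e)"
    using True by (simp add: power_int_def inverse_eq_divide power_one_over)
  ultimately have "is_pole (\<lambda>z::complex. z powi e) 0" by (simp only:)
  then show ?thesis using True by simp
next
  case False
  then have "(\<lambda>z. c * z powi e) analytic_on {a}" by (intro monomial_analytic) auto
  then show ?thesis using False not_is_pole_holomorphic by (auto simp: analytic_at)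
qed

lemma monomial_nicely_meromorphic:
  "(\<lambda>z::complex. c * z powi e) nicely_meromorphic_on S"
  unfolding nicely_meromorphic_on_def
proof (intro conjI ballI)
  show "(\<lambda>z. c * z powi e) meromorphic_on S"
    by (intro meromorphic_intros)
  fix z :: complex
  show "is_pole (\<lambda>z. c * z powi e) z \<and> c * z powi e = 0 \<or> (\<lambda>z. c * z powi e) \<midarrow>z\<rightarrow> c * z powi e"
  proof (cases "is_pole (\<lambda>z. c * z powi e) z")
    case True
    then show ?thesis by (auto simp: is_pole_monomial_iff)
  next
    case False
    then have "(\<lambda>z. c * z powi e) analytic_on {z}"
      unfolding is_pole_monomial_iff by (intro monomial_analytic) auto
    then show ?thesis using analytic_at_imp_isCont isContD by blast
  qed
qed

text \<open>A polynomial in \<open>z\<close> and \<open>cnj z\<close> has coefficient functions that are polynomials in \<open>z\<close>. By uniqueness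
  they agree with the given monomials off \<open>0\<close>, so none of these can have a pole. The two
  families may have different lengths; both are continued by zero to a common length.\<close>

lemma not_polynomial_if_pole:
  fixes c :: "nat \<Rightarrow> complex" and e :: "nat \<Rightarrow> int"
  assumes f: "\<And>z. z \<in> punctured_disc \<Longrightarrow> f z = (\<Sum>k<N. cnj z ^ k * (c k * z powi e k))"
    and k: "k < N" "c k \<noteq> 0" "e k < 0"
  shows "\<not> polynomial_z_cnj_on punctured_disc f"
proof
  assume "polynomial_z_cnj_on punctured_disc f"
  then obtain d C where C: "\<And>z. z \<in> punctured_disc \<Longrightarrow> f z = (\<Sum>i\<le>d. \<Sum>j\<le>d. C i j * z ^ i * cnj z ^ j)"
    unfolding polynomial_z_cnj_on_def by blast
  define p where "p j z = (if j \<le> d then \<Sum>i\<le>d. C i j * z ^ i else 0)" for j and z :: complex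
  define q where "q j z = (if j < N then c j * z powi e j else 0)" for j z
  have p_hol: "p j holomorphic_on S" for j S
    unfolding p_def[abs_def] by (cases "j \<le> d") (auto intro!: holomorphic_intros)
  have q_hol: "q j holomorphic_on punctured_disc" for j
    unfolding q_def[abs_def] by (cases "j < N") (auto intro!: holomorphic_intros)
  have "(\<Sum>j<N + Suc d. cnj z ^ j * (p j z - q j z)) = 0" if "z \<in> punctured_disc" for z
  proof -
    have "(\<Sum>j<N + Suc d. cnj z ^ j * p j z) = (\<Sum>j\<le>d. cnj z ^ j * p j z)"
      by (rule sum.mono_neutral_right) (auto simp: p_def)
    also have "\<dots> = (\<Sum>j\<le>d. \<Sum>i\<le>d. C i j * z ^ i * cnj z ^ j)"
      by (intro sum.cong) (simp_all add: p_def sum_distrib_left mult.commute)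
    also have "\<dots> = f z" unfolding C[OF that] by (rule sum.swap)
    also have "\<dots> = (\<Sum>j<N. cnj z ^ j * q j z)"
      unfolding f[OF that] by (intro sum.cong) (simp_all add: q_def)
    also have "\<dots> = (\<Sum>j<N + Suc d. cnj z ^ j * q j z)"
      by (rule sum.mono_neutral_left) (auto simp: q_def)
    finally show ?thesis by (simp add: right_diff_distrib sum_subtractf)
  qed
  moreover have "(\<lambda>z. p j z - q j z) holomorphic_on punctured_disc" for j
    by (intro holomorphic_intros p_hol q_hol)
  moreover have "open punctured_disc" by (simp add: open_delete)
  ultimately have "p k z - q k z = 0" if "z \<in> punctured_disc" for z
    using cnj_power_coeffs_unique[of punctured_disc "N + Suc d" "\<lambda>j z. p j z - q j z" k z] that k(1)
    by (metis trans_less_add1)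
  then have eq: "c k * z powi e k = p k z" if "z \<in> punctured_disc" for z
    using that k(1) by (simp add: q_def)
  have pole: "is_pole (\<lambda>z. c k * z powi e k) 0"
    using k(2,3) by (simp add: is_pole_monomial_iff)
  have "eventually (\<lambda>z. z \<in> punctured_disc) (at 0)"
    by (intro eventually_at_in_open) auto
  then have "eventually (\<lambda>z. c k * z powi e k = p k z) (at 0)"
    by eventually_elim (rule eq)
  then have "is_pole (p k) 0"
    by (rule is_pole_transform[OF pole]) simp
  then show False
    using not_is_pole_holomorphic[OF open_UNIV UNIV_I p_hol] by blast
qed

text \<open>The monomials themselves are coefficient functions. The value \<open>f 0\<close> is no obstacle: by the assumption
  on \<open>k\<close>, the origin is a pole of one of them, and the expansion is only required off the poles.\<close>

lemma poly_meromorphic_on_unit_disc: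
  fixes c :: "nat \<Rightarrow> complex" and e :: "nat \<Rightarrow> int"
  assumes f: "\<And>z. z \<in> punctured_disc \<Longrightarrow> f z = (\<Sum>k<N. cnj z ^ k * (c k * z powi e k))"
    and k: "k < N" "c k \<noteq> 0" "e k < 0"
  shows "poly_meromorphic_on unit_disc N f"
proof -
  let ?\<psi> = "\<lambda>k z. c k * z powi e k"
  have "0 \<in> coeff_poles unit_disc N ?\<psi>"
    using k by (auto simp: coeff_poles_def is_pole_monomial_iff)
  then have "f z = (\<Sum>k<N. cnj z ^ k * ?\<psi> k z)" if "z \<in> unit_disc - coeff_poles unit_disc N ?\<psi>" for z
    using that by (intro f) auto
  then have "poly_meromorphic_coeffs unit_disc N ?\<psi> f"
    by (simp add: poly_meromorphic_coeffs_def monomial_nicely_meromorphic)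
  then show ?thesis unfolding poly_meromorphic_on_def by blast
qed

text \<open>Meromorphic functions have isolated singularities, so a small punctured disc around \<open>a\<close> contains no
  pole of any \<open>\<psi> k\<close>. There, uniqueness of the coefficients applies.\<close>

lemma poly_meromorphic_coeffs_near:
  fixes c :: "nat \<Rightarrow> complex" and e :: "nat \<Rightarrow> int"
  assumes f: "\<And>z. z \<in> punctured_disc \<Longrightarrow> f z = (\<Sum>k<N. cnj z ^ k * (c k * z powi e k))"
    and \<psi>: "poly_meromorphic_coeffs unit_disc N \<psi> f"
    and a: "a \<in> unit_disc"
  obtains r where "r > 0"
    "\<And>k z. k < N \<Longrightarrow> z \<in> ball a r - {a} \<Longrightarrow> \<psi> k z = c k * z powi e k"
proof -
  have mero: "\<psi> k meromorphic_on unit_disc" if "k < N" for k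
    using \<psi> that by (auto simp: poly_meromorphic_coeffs_def nicely_meromorphic_on_def)
  have "eventually (\<lambda>z. \<psi> k analytic_on {z}) (at a)" if "k < N" for k
    using meromorphic_on_isolated_singularity[OF meromorphic_on_subset[OF mero[OF that]], of a] a
    by (simp add: isolated_singularity_at_altdef)
  then have "eventually (\<lambda>z. \<forall>k\<in>{..<N}. \<psi> k analytic_on {z}) (at a)"
    by (intro eventually_ball_finite) auto
  moreover have "eventually (\<lambda>z. z \<in> unit_disc - {a}) (at a)"
    using a by (intro eventually_at_in_open) auto
  moreover have "eventually (\<lambda>z. z \<noteq> 0) (at a)"
    by (rule eventually_neq_at_within)
  ultimately have "eventually (\<lambda>z. (\<forall>k<N. \<psi> k analytic_on {z}) \<and> z \<in> punctured_disc) (at a)"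
    by eventually_elim auto
  then obtain r where r: "r > 0" and
    *: "\<And>z. z \<in> ball a r - {a} \<Longrightarrow> (\<forall>k<N. \<psi> k analytic_on {z}) \<and> z \<in> punctured_disc"
    by (fastforce simp: eventually_at dist_commute)
  let ?S = "ball a r - {a}"
  have hol: "\<psi> k holomorphic_on ?S" if "k < N" for k
    using * that by (meson analytic_imp_holomorphic analytic_on_analytic_at)
  have "z \<notin> coeff_poles unit_disc N \<psi>" if "z \<in> ?S" for z
    using not_is_pole_holomorphic[OF _ that hol] by (auto simp: coeff_poles_def open_delete)
  then have "(\<Sum>k<N. cnj z ^ k * \<psi> k z) = (\<Sum>k<N. cnj z ^ k * (c k * z powi e k))" if "z \<in> ?S" for z
    using \<psi> f[of z] *[OF that] that by (auto simp: poly_meromorphic_coeffs_def)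
  then have sum0: "(\<Sum>k<N. cnj z ^ k * (\<psi> k z - c k * z powi e k)) = 0" if "z \<in> ?S" for z
    using that by (simp add: right_diff_distrib sum_subtractf)
  have diff_hol: "(\<lambda>z. \<psi> k z - c k * z powi e k) holomorphic_on ?S" if "k < N" for k
    using * that by (intro holomorphic_intros hol) auto
  have "open ?S" by (simp add: open_delete)
  have "\<psi> k z - c k * z powi e k = 0" if "k < N" "z \<in> ?S" for k z
    using cnj_power_coeffs_unique[of ?S N "\<lambda>k z. \<psi> k z - c k * z powi e k" k z]
      \<open>open ?S\<close> diff_hol sum0 that by blast
  then show thesis using that r by simp
qed

text \<open>Poles and their orders depend only on the germ at the punctured point, so the \<open>\<psi> k\<close> have those of the
  monomials \<open>c k * z powi e k\<close>. The index \<open>k0\<close> of the smallest exponent determines the multiplicity.\<close>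

lemma poles_of_poly_meromorphic_coeffs:
  fixes c :: "nat \<Rightarrow> complex" and e :: "nat \<Rightarrow> int"
  assumes f: "\<And>z. z \<in> punctured_disc \<Longrightarrow> f z = (\<Sum>k<N. cnj z ^ k * (c k * z powi e k))"
    and \<psi>: "poly_meromorphic_coeffs unit_disc N \<psi> f"
    and k0: "k0 < N" "c k0 \<noteq> 0" "e k0 < 0"
    and least: "\<And>k. k < N \<Longrightarrow> c k \<noteq> 0 \<Longrightarrow> e k0 \<le> e k"
  shows "coeff_poles unit_disc N \<psi> = {0}"
    and "int (pole_multiplicity N \<psi> 0) = - e k0"
proof -
  have pole_iff: "is_pole (\<psi> k) a \<longleftrightarrow> a = 0 \<and> c k \<noteq> 0 \<and> e k < 0"
    if k: "k < N" and a: "a \<in> unit_disc" for k a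
  proof -
    obtain r where r: "r > 0" "\<And>k z. k < N \<Longrightarrow> z \<in> ball a r - {a} \<Longrightarrow> \<psi> k z = c k * z powi e k"
      using poly_meromorphic_coeffs_near[OF f \<psi> a] by blast
    have "eventually (\<lambda>z. z \<in> ball a r - {a}) (at a)"
      using r(1) by (intro eventually_at_in_open) auto
    then have "eventually (\<lambda>z. \<psi> k z = c k * z powi e k) (at a)"
      by eventually_elim (rule r(2)[OF k])
    then have "is_pole (\<psi> k) a \<longleftrightarrow> is_pole (\<lambda>z. c k * z powi e k) a"
      by (intro is_pole_cong) simp_all
    then show ?thesis by (simp only: is_pole_monomial_iff)
  qed
  show "coeff_poles unit_disc N \<psi> = {0}"
  proof (rule set_eqI)
    fix a
    show "a \<in> coeff_poles unit_disc N \<psi> \<longleftrightarrow> a \<in> {0}"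
      using pole_iff[of _ a] k0 by (auto simp: coeff_poles_def)
  qed
  have order: "pole_order (\<psi> k) 0 = (if c k = 0 then 0 else nat (- e k))" if "k < N" for k
  proof (cases "c k \<noteq> 0 \<and> e k < 0")
    case True
    obtain r where r: "r > 0" "\<And>k z. k < N \<Longrightarrow> z \<in> ball 0 r - {0} \<Longrightarrow> \<psi> k z = c k * z powi e k"
      using poly_meromorphic_coeffs_near[OF f \<psi>, of 0] by auto
    have "zorder (\<psi> k) 0 = e k"
      by (rule zorder_eqI[where S = "ball 0 r" and g = "\<lambda>_. c k"]) (use True r that in auto)
    then show ?thesis
      using True pole_iff[OF that, of 0] by (simp add: pole_order_def)
  next
    case False
    then show ?thesis
      using pole_iff[OF that, of 0] by (auto simp: pole_order_def)
  qed
  have "pole_multiplicity N \<psi> 0 = nat (- e k0)"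
    unfolding pole_multiplicity_def
  proof (rule Max_eqI)
    fix y assume "y \<in> (\<lambda>k. pole_order (\<psi> k) 0) ` {..<N}"
    then obtain k where "k < N" "y = pole_order (\<psi> k) 0" by auto
    then show "y \<le> nat (- e k0)"
      using order[of k] least[of k] by (auto intro: nat_mono)
  next
    show "nat (- e k0) \<in> (\<lambda>k. pole_order (\<psi> k) 0) ` {..<N}"
      using order[OF k0(1)] k0 by (intro image_eqI[of _ _ k0]) auto
  qed simp
  then show "int (pole_multiplicity N \<psi> 0) = - e k0" using k0(3) by simp
qed

section \<open>Polynomiality and poles of the fractional Zernike functions\<close>

theorem theorem3p10:
  fixes \<rho> \<kappa> :: real and m :: nat and n :: int
  assumes "\<rho> > -1" and "\<kappa> > -1" and "of_int n + \<rho> \<ge> 0"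
  shows "(polynomial_z_cnj_on punctured_disc (frac_zernike \<kappa> \<rho> m n) \<longleftrightarrow> \<rho> = 0 \<or> int m \<le> n) \<and>
    (\<not> (\<rho> = 0 \<or> int m \<le> n) \<longrightarrow>
       poly_meromorphic_on unit_disc (Suc m) (frac_zernike \<kappa> \<rho> m n) \<and>
       (\<forall>\<psi>. poly_meromorphic_coeffs unit_disc (Suc m) \<psi> (frac_zernike \<kappa> \<rho> m n) \<longrightarrow>
          coeff_poles unit_disc (Suc m) \<psi> = {0} \<and>
          (\<rho> \<in> \<nat> - {0} \<and> real m > of_int n + \<rho> \<longrightarrow>
             real (pole_multiplicity (Suc m) \<psi> 0) = \<rho>) \<and>
          (int m > n \<and> \<rho> \<notin> \<int> \<or>
           \<rho> \<in> \<nat> - {0} \<and> n < int m \<and> real m \<le> of_int n + \<rho> \<longrightarrow>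
             int (pole_multiplicity (Suc m) \<psi> 0) = int m - n)))"
proof -
  define a where "a = of_int n + \<rho>"
  define c where "c k = complex_of_real (zernike_coeff \<kappa> a m k)" for k
  define e where "e k = n - int m + int k" for k
  let ?Z = "frac_zernike \<kappa> \<rho> m n"
  have Z: "?Z z = (\<Sum>k<Suc m. cnj z ^ k * (c k * z powi e k))" if "z \<in> punctured_disc" for z
    using frac_zernike_expansion[OF that] by (simp only: c_def e_def a_def lessThan_Suc_atMost)
  have c0: "c k = 0 \<longleftrightarrow> a \<in> \<nat> \<and> a < real (m - k)" if "k < Suc m" for k
    using zernike_coeff_eq_0_iff[of \<kappa> a k m] assms that by (simp add: c_def a_def)
  show ?thesis
  proof (cases "\<rho> = 0 \<or> int m \<le> n")
    case True
    have "e k \<ge> 0" if "k < Suc m" "c k \<noteq> 0" for k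
    proof (cases "int m \<le> n")
      case False
      with True have "\<rho> = 0" by simp
      then have a: "a = of_int n" and "n \<ge> 0" using assms(3) by (simp_all add: a_def)
      then have "a \<in> \<nat>" by (metis of_nat_in_Nats nonneg_int_cases of_int_of_nat_eq)
      then have "real (m - k) \<le> of_int n" using c0[OF that(1)] that(2) a by simp
      then have "int (m - k) \<le> n" by linarith
      then show ?thesis by (simp add: e_def)
    qed (simp add: e_def)
    then have "polynomial_z_cnj_on punctured_disc ?Z"
      using polynomial_if_exponents_nonneg[OF Z] by blast
    with True show ?thesis by blast
  next
    case False
    have nat_rho: "\<rho> \<in> \<nat> - {0}" if "\<rho> \<in> \<int>"
    proof -
      from that obtain i where i: "\<rho> = of_int i" by (auto elim: Ints_cases)
      with assms(1) have "i \<ge> 0" by linarith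
      with i have "\<rho> = of_nat (nat i)" by simp
      then have "\<rho> \<in> \<nat>" by (metis of_nat_in_Nats)
      with False show ?thesis by simp
    qed
    \<comment> \<open>The least index with a nonzero coefficient; the difference is truncated at \<open>0\<close> when \<open>a \<ge> m\<close>.\<close>
    define k0 where "k0 = (if \<rho> \<in> \<int> then m - nat \<lfloor>a\<rfloor> else 0)"
    have facts: "c k0 \<noteq> 0 \<and> e k0 < 0 \<and> (\<forall>k<Suc m. c k \<noteq> 0 \<longrightarrow> k0 \<le> k) \<and>
       (\<rho> \<in> \<int> \<and> real m > a \<longrightarrow> - of_int (e k0) = \<rho>) \<and> (\<rho> \<notin> \<int> \<or> real m \<le> a \<longrightarrow> k0 = 0)"
    proof (cases "\<rho> \<in> \<int>")
      case rho: True
      then obtain p where p: "\<rho> = real p" "p > 0" using nat_rho by (auto elim!: Nats_cases)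
      define q where "q = nat (n + int p)"
      have "a = of_int (n + int p)" by (simp add: a_def p)
      moreover from this have "n + int p \<ge> 0" using assms(3) unfolding a_def by linarith
      ultimately have q: "int q = n + int p" "a = real q" by (simp_all add: q_def)
      then have "k0 = m - q" using rho by (simp add: k0_def)
      moreover have "c k = 0 \<longleftrightarrow> q < m - k" if "k < Suc m" for k
        using c0[OF that] q(2) by simp
      ultimately show ?thesis using q p False by (auto simp: e_def)
    next
      case nonint: False
      have "a \<notin> \<nat>"
      proof
        assume "a \<in> \<nat>"
        then have "a - of_int n \<in> \<int>" using Nats_subset_Ints by (intro Ints_diff) auto
        with nonint show False by (simp add: a_def)
      qed
      then show ?thesis using nonint False c0[of 0] by (auto simp: k0_def e_def)
    qed
    have k0: "k0 < Suc m" by (simp add: k0_def less_Suc_eq_le)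
    have "\<not> polynomial_z_cnj_on punctured_disc ?Z"
      using not_polynomial_if_pole[OF Z k0] facts by blast
    moreover have "poly_meromorphic_on unit_disc (Suc m) ?Z"
      using poly_meromorphic_on_unit_disc[OF Z k0] facts by blast
    moreover have "coeff_poles unit_disc (Suc m) \<psi> = {0} \<and>
          (\<rho> \<in> \<nat> - {0} \<and> real m > of_int n + \<rho> \<longrightarrow> real (pole_multiplicity (Suc m) \<psi> 0) = \<rho>) \<and>
          (int m > n \<and> \<rho> \<notin> \<int> \<or> \<rho> \<in> \<nat> - {0} \<and> n < int m \<and> real m \<le> of_int n + \<rho> \<longrightarrow>
             int (pole_multiplicity (Suc m) \<psi> 0) = int m - n)"
      if \<psi>: "poly_meromorphic_coeffs unit_disc (Suc m) \<psi> ?Z" for \<psi>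
    proof -
      have least: "e k0 \<le> e k" if "k < Suc m" "c k \<noteq> 0" for k
        using facts that by (simp add: e_def)
      have "coeff_poles unit_disc (Suc m) \<psi> = {0}"
        and mult: "int (pole_multiplicity (Suc m) \<psi> 0) = - e k0"
        using poles_of_poly_meromorphic_coeffs[OF Z \<psi> k0 _ _ least] facts by blast+
      moreover have "real (pole_multiplicity (Suc m) \<psi> 0) = - of_int (e k0)"
        using arg_cong[OF mult, of real_of_int] by simp
      moreover have "\<rho> \<in> \<int>" if "\<rho> \<in> \<nat>" using that Nats_subset_Ints by blast
      ultimately show ?thesis using facts by (auto simp: a_def e_def)
    qed
    ultimately show ?thesis using False by blast
  qed
qed

end
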